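(* Let $a\in\mathbb{R}$, $\alpha\in(0,1)$, and let $w:\mathbb{N}_a\to\mathbb{R}\setminus\{0\}$ satisfy $\frac{w(a)}{w(k)}>0$ for all $k\in\mathbb{N}_{a+1}$. Let $x,y:\mathbb{N}_a\to\mathbb{R}$ satisfy $x(a)=y(a)$ and $${}_a^{\rm C}\nabla_k^{\alpha,w(k)}x(k)\ge {}_a^{\rm C}\nabla_k^{\alpha,w(k)}y(k)\quad\text{for all }k\in\mathbb{N}_{a+1}.$$ Then $x(k)\ge y(k)$ for all $k\in\mathbb{N}_{a+1}$.
   Context: For $a\in\mathbb{R}$, $\mathbb{N}_a:=\{a,a+1,a+2,\dots\}$. The nabla difference is $\nabla x(k):=x(k)-x(k-1)$. For $\beta\in(-1,1)$ and $k\in\mathbb{N}_{a+1}$, the Grünwald–Letnikov difference/sum is $${}_a^{\rm G}\nabla_k^{\beta}x(k):=\sum_{i=0}^{k-a-1}(-1)^i\binom{\beta}{i}x(k-i),\qquad \binom{p}{q}:=\frac{\Gamma(p+1)}{\Gamma(q+1)\Gamma(p-q+1)}.$$ For $\alpha\in(0,1)$ and $k\in\mathbb{N}_{a+1}$, the Caputo difference is ${}_a^{\rm C}\nabla_k^{\alpha}x(k):={}_a^{\rm G}\nabla_k^{\alpha-1}\nabla x(k)$. Given a tempered function $w$, the Caputo tempered difference is ${}_a^{\rm C}\nabla_k^{\alpha,w(k)}x(k):=w^{-1}(k)\,{}_a^{\rm C}\nabla_k^{\alpha}[w(k)x(k)]$, where $w^{-1}(k)=1/w(k)$. *)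

theory Defs
  imports "HOL-Analysis.Analysis"
begin

definition nats_from :: "real \<Rightarrow> real set" where
  "nats_from a = {a + real n | n. True}"

text \<open>Functions on \<^term>\<open>nats_from a\<close> are represented by functions on all reals. For
  \<^term>\<open>k \<in> nats_from (a + 1)\<close> the operators below only evaluate their argument on
  \<^term>\<open>nats_from a\<close>, so the values elsewhere are irrelevant.\<close>

definition nabla :: "(real \<Rightarrow> real) \<Rightarrow> real \<Rightarrow> real" where
  "nabla x k = x k - x (k - 1)"

text \<open>At its poles the library's Gamma function is 0, and division by 0 yields 0. In the
  denominator this agrees with the usual convention that 1/Gamma vanishes at the poles.\<close>

definition gamma_binomial :: "real \<Rightarrow> real \<Rightarrow> real" where
  "gamma_binomial p q = Gamma (p + 1) / (Gamma (q + 1) * Gamma (p - q + 1))"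

lemma gamma_binomial_eq_gbinomial:
  assumes "\<beta> > -1"
  shows "gamma_binomial \<beta> (real i) = \<beta> gchoose i"
proof -
  have "\<beta> + 1 \<notin> \<int>\<^sub>\<le>\<^sub>0"
    using assms by (auto elim!: nonpos_Ints_cases)
  then show ?thesis
    by (simp add: gamma_binomial_def gbinomial_Gamma Gamma_fact add.commute)
qed

text \<open>Grunwald-Letnikov difference/sum of order \<open>\<beta>\<close>, used for \<open>\<beta> \<in> (-1, 1)\<close> and
  \<open>k \<in> nats_from (a + 1)\<close>; the index set is then \<open>{0, \<dots>, k - a - 1}\<close>.\<close>

definition gl_diff :: "real \<Rightarrow> real \<Rightarrow> (real \<Rightarrow> real) \<Rightarrow> real \<Rightarrow> real" where
  "gl_diff a \<beta> x k =
     (\<Sum>i | real i \<le> k - a - 1. (-1) ^ i * gamma_binomial \<beta> (real i) * x (k - real i))"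

definition caputo_diff :: "real \<Rightarrow> real \<Rightarrow> (real \<Rightarrow> real) \<Rightarrow> real \<Rightarrow> real" where
  "caputo_diff a \<alpha> x k = gl_diff a (\<alpha> - 1) (nabla x) k"

definition caputo_tempered_diff ::
    "real \<Rightarrow> real \<Rightarrow> (real \<Rightarrow> real) \<Rightarrow> (real \<Rightarrow> real) \<Rightarrow> real \<Rightarrow> real" where
  "caputo_tempered_diff a \<alpha> w x k = 1 / w k * caputo_diff a \<alpha> (\<lambda>j. w j * x j) k"

end

theory Submission
  imports Defs
begin

text \<open>
  The operator is linear in its argument, so the statement concerns \<open>x - y\<close> only. The hypothesis
  on \<open>w\<close> says that \<open>w k\<close> has the sign of \<open>w a\<close> on the whole grid. Hence multiplication by
  \<open>w a * w k > 0\<close> removes the outer factor \<open>1 / w k\<close>, and it suffices to show that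
  \<open>u n = w a * w (a + n) * (x (a + n) - y (a + n))\<close>, which satisfies \<open>u 0 = 0\<close> and has
  nonnegative untempered Caputo differences, is nonnegative.

  The Caputo difference of \<open>u\<close> is the convolution of the increments of \<open>u\<close> with the kernel
  \<open>c i = (-1) ^ i * (\<alpha> - 1 gchoose i)\<close>. Summation by parts (\<open>convolution_increments_by_parts\<close>)
  moves the difference onto the kernel. Since \<open>0 < \<alpha> < 1\<close>, the kernel starts at \<open>1\<close>, is nonnegative
  and decreases (\<open>caputo_kernel_Suc_le\<close>). So the newest value \<open>u (n + 1)\<close> enters with the
  coefficient \<open>1\<close> and all the older values with nonpositive coefficients: nonnegativity of the
  Caputo difference bounds \<open>u (n + 1)\<close> below by a nonnegative combination of the older values,
  and strong induction finishes the proof (\<open>nonneg_if_convolution_increments_nonneg\<close>).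
\<close>

lemma convolution_increments_by_parts:
  fixes c u :: "nat \<Rightarrow> 'a::comm_ring"
  shows "(\<Sum>i\<le>m. c i * (u (Suc m - i) - u (m - i))) =
    c 0 * u (Suc m) - (\<Sum>i<m. (c i - c (Suc i)) * u (m - i)) - c m * u 0"
proof -
  have "(\<Sum>i\<le>m. c i * u (Suc m - i)) = c 0 * u (Suc m) + (\<Sum>i<m. c (Suc i) * u (m - i))"
    by (simp add: lessThan_Suc_atMost [symmetric] sum.lessThan_Suc_shift del: sum.lessThan_Suc)
  moreover have "(\<Sum>i\<le>m. c i * u (m - i)) = (\<Sum>i<m. c i * u (m - i)) + c m * u 0"
    by (simp add: lessThan_Suc_atMost [symmetric])
  ultimately show ?thesis
    by (simp add: algebra_simps sum_subtractf)
qed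

text \<open>A discrete maximum principle: after summation by parts every value of \<open>u\<close> but the newest
  one has a nonpositive coefficient, so the first negative value would make the convolution
  negative.\<close>

lemma nonneg_if_convolution_increments_nonneg:
  fixes c u :: "nat \<Rightarrow> 'a::linordered_idom"
  assumes c0: "c 0 > 0"
    and c_nonneg: "\<And>i. c i \<ge> 0"
    and c_dec: "\<And>i. c (Suc i) \<le> c i"
    and u0: "u 0 \<ge> 0"
    and conv: "\<And>m. (\<Sum>i\<le>m. c i * (u (Suc m - i) - u (m - i))) \<ge> 0"
  shows "u n \<ge> 0"
proof (induction n rule: less_induct)
  case (less n)
  show ?case
  proof (cases n)
    case 0
    then show ?thesis using u0 by simp
  next
    case (Suc m)
    have "(\<Sum>i<m. (c i - c (Suc i)) * u (m - i)) \<ge> 0"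
      using less.IH c_dec Suc by (intro sum_nonneg mult_nonneg_nonneg) auto
    moreover have "c m * u 0 \<ge> 0"
      using c_nonneg u0 by simp
    ultimately have "c 0 * u (Suc m) \<ge> 0"
      using conv [of m] unfolding convolution_increments_by_parts by linarith
    then show ?thesis
      using c0 Suc by (simp add: zero_le_mult_iff)
  qed
qed

definition caputo_kernel :: "real \<Rightarrow> nat \<Rightarrow> real" where
  "caputo_kernel \<alpha> i = (-1) ^ i * (\<alpha> - 1 gchoose i)"

lemma caputo_kernel_0 [simp]: "caputo_kernel \<alpha> 0 = 1"
  by (simp add: caputo_kernel_def)

lemma caputo_kernel_Suc:
  "caputo_kernel \<alpha> (Suc i) = (1 - \<alpha> / real (Suc i)) * caputo_kernel \<alpha> i"
proof -
  have "real (Suc i) * (\<alpha> - 1 gchoose Suc i) = (\<alpha> - real (Suc i)) * (\<alpha> - 1 gchoose i)"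
    using gbinomial_mult_1 [of "\<alpha> - 1" i] by (simp add: algebra_simps)
  then have "(\<alpha> - 1 gchoose Suc i) = - ((1 - \<alpha> / real (Suc i)) * (\<alpha> - 1 gchoose i))"
    by (simp add: field_simps)
  then show ?thesis
    by (simp only: caputo_kernel_def power_Suc) simp
qed

lemma caputo_kernel_nonneg:
  assumes "\<alpha> \<le> 1"
  shows "caputo_kernel \<alpha> i \<ge> 0"
proof (induction i)
  case (Suc i)
  have "1 - \<alpha> / real (Suc i) \<ge> 0"
    using assms by (simp add: field_simps)
  then show ?case
    unfolding caputo_kernel_Suc using Suc.IH by (rule mult_nonneg_nonneg)
qed simp

text \<open>Consecutive kernel values have the ratio \<open>1 - \<alpha> / (i + 1)\<close>, which lies in \<open>[0, 1]\<close>; this is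
  where both bounds on the order \<open>\<alpha>\<close> are needed.\<close>

lemma caputo_kernel_Suc_le:
  assumes "0 \<le> \<alpha>" "\<alpha> \<le> 1"
  shows "caputo_kernel \<alpha> (Suc i) \<le> caputo_kernel \<alpha> i"
  unfolding caputo_kernel_Suc
  using assms caputo_kernel_nonneg [of \<alpha> i] by (intro mult_left_le_one_le) auto

lemma caputo_diff_eq_convolution:
  assumes "\<alpha> > 0"
  shows "caputo_diff a \<alpha> f (a + real (Suc m)) =
    (\<Sum>i\<le>m. caputo_kernel \<alpha> i * (f (a + real (Suc m - i)) - f (a + real (m - i))))"
proof -
  have "{i. real i \<le> a + real (Suc m) - a - 1} = {..m}"
    by auto
  moreover have "nabla f (a + real (Suc m) - real i) = f (a + real (Suc m - i)) - f (a + real (m - i))"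
    if "i \<le> m" for i
    using that by (simp add: nabla_def of_nat_diff algebra_simps)
  moreover have "\<alpha> - 1 > -1"
    using assms by simp
  ultimately show ?thesis
    unfolding caputo_diff_def gl_diff_def caputo_kernel_def
    by (intro sum.cong) (simp_all only: gamma_binomial_eq_gbinomial atMost_iff)
qed

theorem theorem3p3:
  fixes a \<alpha> :: real and w x y :: "real \<Rightarrow> real"
  assumes "0 < \<alpha>" and "\<alpha> < 1"
    and "\<forall>k\<in>nats_from a. w k \<noteq> 0"
    and "\<forall>k\<in>nats_from (a + 1). w a / w k > 0"
    and "x a = y a"
    and "\<forall>k\<in>nats_from (a + 1). caputo_tempered_diff a \<alpha> w x k \<ge> caputo_tempered_diff a \<alpha> w y k"
  shows "\<forall>k\<in>nats_from (a + 1). x k \<ge> y k"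
proof -
  have grid: "k \<in> nats_from (a + 1) \<longleftrightarrow> (\<exists>m. k = a + real (Suc m))" for k
    by (auto simp: nats_from_def add_ac)
  have w_sign: "w a * w (a + real (Suc m)) > 0" for m
    using assms(4) grid by (auto simp: zero_less_divide_iff zero_less_mult_iff)
  define u where "u n = w a * (w (a + real n) * (x (a + real n) - y (a + real n)))" for n
  have "u n \<ge> 0" for n
  proof (rule nonneg_if_convolution_increments_nonneg [where c = "caputo_kernel \<alpha>"])
    fix m
    let ?k = "a + real (Suc m)"
    let ?C = "\<lambda>z. caputo_diff a \<alpha> (\<lambda>j. w j * z j) ?k"
    have "1 / w ?k * ?C x \<ge> 1 / w ?k * ?C y"
      using assms(6) grid unfolding caputo_tempered_diff_def by blast
    then have "w a * w ?k * (1 / w ?k * ?C x) \<ge> w a * w ?k * (1 / w ?k * ?C y)"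
      by (rule mult_left_mono [OF _ less_imp_le [OF w_sign]])
    moreover have "w ?k \<noteq> 0"
      using w_sign [of m] by auto
    ultimately have "0 \<le> w a * (?C x - ?C y)"
      by (simp add: right_diff_distrib)
    also have "\<dots> = (\<Sum>i\<le>m. caputo_kernel \<alpha> i * (u (Suc m - i) - u (m - i)))"
      unfolding caputo_diff_eq_convolution [OF assms(1)] u_def
        sum_subtractf [symmetric] sum_distrib_left
      by (intro sum.cong refl) (simp only: right_diff_distrib, algebra)
    finally show "0 \<le> (\<Sum>i\<le>m. caputo_kernel \<alpha> i * (u (Suc m - i) - u (m - i)))" .
  qed (use assms in \<open>auto simp: u_def intro: caputo_kernel_nonneg caputo_kernel_Suc_le\<close>)
  then have "(w a * w (a + real (Suc m))) * (x (a + real (Suc m)) - y (a + real (Suc m))) \<ge> 0" for m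
    unfolding u_def mult.assoc .
  then have "x (a + real (Suc m)) - y (a + real (Suc m)) \<ge> 0" for m
    using w_sign [of m] zero_le_mult_iff not_less_iff_gr_or_eq by (metis leD)
  then show ?thesis
    using grid by fastforce
qed

end
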